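(* Let $N,M$ be positive integers, let $\mathcal A,\mathcal M\in\mathbb C^{N\times N}$ with $\mathcal A$ Hermitian positive semi-definite and $\mathcal M$ Hermitian positive definite, let $\mathcal B\in\mathbb C^{N\times M}$ satisfy $\mathcal A\mathcal M^{-1}\mathcal B=0$, let $\mathcal U\in\mathbb C^{M\times M}$ be Hermitian positive definite, let $c\ge 0$ be real, let $\mathcal F\in\mathbb C^N$ and let $0\neq\mathcal G\in\operatorname{Im}\mathcal B^*\subset\mathbb C^M$. Suppose $\dim\mathbb C_0=0$. Then the constrained system $$(\mathcal A+c\mathcal M)u+\mathcal B p=\mathcal F,\qquad \mathcal B^* u=\mathcal G\qquad (u\in\mathbb C^N,\ p\in\mathbb C^M)$$ has a solution $(u,p)$ whose component $u$ is unique, and this $u$ is obtained as follows: there are unique $u_g,\tilde u\in\mathbb C^N$ with $$(\mathcal A+\mathcal B\mathcal U\mathcal B^* )u_g=\mathcal B\mathcal U\mathcal G,\qquad (\mathcal A+\mathcal B\mathcal U\mathcal B^* )\tilde u=\mathcal F,$$ and then $u$ is the unique solution in $\mathbb C^N$ of $$(\mathcal A+\mathcal B\mathcal U\mathcal B^*+c\mathcal M)u=\mathcal F-\mathcal B\mathcal U\mathcal B^*\tilde u+\mathcal B\mathcal U\mathcal G+c\mathcal M u_g.$$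
   Context: $X^*$ denotes the conjugate transpose of a matrix $X$. $\mathbb C_0:=\operatorname{Ker}\mathcal A\cap\operatorname{Ker}(\mathcal B\mathcal U\mathcal B^* )\subset\mathbb C^N$. *)

theory Defs
  imports "HOL-Analysis.Analysis"
begin

definition conj_transpose :: "complex ^ 'm ^ 'n \<Rightarrow> complex ^ 'n ^ 'm" where
  "conj_transpose X = map_matrix cnj (transpose X)"

definition hermitian :: "complex ^ 'n ^ 'n \<Rightarrow> bool" where
  "hermitian X \<longleftrightarrow> conj_transpose X = X"

definition sesq_form :: "complex ^ 'n ^ 'n \<Rightarrow> complex ^ 'n \<Rightarrow> complex" where
  "sesq_form X v = (\<Sum>i\<in>UNIV. cnj (v $ i) * (X *v v) $ i)"

text \<open>For a Hermitian matrix \<open>sesq_form X v\<close> is real, so taking \<open>Re\<close> below loses nothing.\<close>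

definition hermitian_psd :: "complex ^ 'n ^ 'n \<Rightarrow> bool" where
  "hermitian_psd X \<longleftrightarrow> hermitian X \<and> (\<forall>v. 0 \<le> Re (sesq_form X v))"

definition hermitian_pd :: "complex ^ 'n ^ 'n \<Rightarrow> bool" where
  "hermitian_pd X \<longleftrightarrow> hermitian X \<and> (\<forall>v. v \<noteq> 0 \<longrightarrow> 0 < Re (sesq_form X v))"

definition mat_Ker :: "complex ^ 'm ^ 'n \<Rightarrow> (complex ^ 'm) set" where
  "mat_Ker X = {v. X *v v = 0}"

definition mat_Im :: "complex ^ 'm ^ 'n \<Rightarrow> (complex ^ 'n) set" where
  "mat_Im X = range (\<lambda>v. X *v v)"

definition C0_space ::
  "complex ^ 'n ^ 'n \<Rightarrow> complex ^ 'm ^ 'n \<Rightarrow> complex ^ 'm ^ 'm \<Rightarrow> (complex ^ 'n) set" where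
  "C0_space A B U = mat_Ker A \<inter> mat_Ker (B ** U ** conj_transpose B)"

end

theory Submission
  imports Defs
begin

text \<open>Because \<open>A M\<inverse> B = 0\<close>, pairing \<open>A x + B q + c M z = 0\<close> with \<open>r = M\<inverse> B q\<close> kills the first term
  and leaves \<open>\<langle>r, M r\<rangle> + c \<langle>q, B\<^sup>* z\<rangle> = 0\<close>. So \<open>B q = 0\<close> whenever \<open>\<langle>q, B\<^sup>* z\<rangle> \<ge> 0\<close>, which gives uniqueness of
  \<open>u\<close> and, for the solution \<open>u\<close> of the augmented system, \<open>B\<^sup>* (u - u\<^sub>g) = 0\<close>.
  Since \<open>B\<^sup>* M\<inverse> B\<close> maps onto \<open>Im B\<^sup>*\<close>, there is \<open>q\<close> with \<open>B\<^sup>* M\<inverse> B q = G\<close>. The vector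
  \<open>M\<inverse> B q\<close> lies in the kernel of \<open>A\<close>, hence equals \<open>u\<^sub>g\<close>. Therefore \<open>B\<^sup>* u = G\<close>, and the term \<open>c M u\<^sub>g = c B q\<close>
  is absorbed by the multiplier \<open>p = U B\<^sup>* u\<^sub>t - c q\<close>.\<close>

section \<open>Hermitian inner product and adjoints\<close>

definition herm_inner :: "complex ^ 'n \<Rightarrow> complex ^ 'n \<Rightarrow> complex" where
  "herm_inner x y = (\<Sum>i\<in>UNIV. cnj (x $ i) * y $ i)"

lemma sesq_form_eq_herm_inner: "sesq_form X v = herm_inner v (X *v v)"
  by (simp add: sesq_form_def herm_inner_def)

lemma herm_inner_zero_right [simp]: "herm_inner x 0 = 0"
  by (simp add: herm_inner_def)

lemma herm_inner_zero_left [simp]: "herm_inner 0 x = 0"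
  by (simp add: herm_inner_def)

lemma herm_inner_add_right: "herm_inner x (y + z) = herm_inner x y + herm_inner x z"
  by (simp add: herm_inner_def algebra_simps sum.distrib)

lemma herm_inner_scaleR_right: "herm_inner x (c *\<^sub>R y) = c *\<^sub>R herm_inner x y"
  by (simp add: herm_inner_def scaleR_sum_right)

lemma herm_inner_adjoint:
  fixes X :: "complex ^ 'm ^ 'n"
  shows "herm_inner x (X *v y) = herm_inner (conj_transpose X *v x) y"
proof -
  have "herm_inner x (X *v y) = (\<Sum>i\<in>UNIV. \<Sum>j\<in>UNIV. cnj (x $ i) * (X $ i $ j * y $ j))"
    by (simp add: herm_inner_def matrix_vector_mult_def sum_distrib_left)
  also have "\<dots> = (\<Sum>j\<in>UNIV. \<Sum>i\<in>UNIV. cnj (x $ i) * (X $ i $ j * y $ j))"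
    by (rule sum.swap)
  also have "\<dots> = herm_inner (conj_transpose X *v x) y"
    by (simp add: herm_inner_def matrix_vector_mult_def conj_transpose_def map_matrix_def
        transpose_def sum_distrib_right sum_distrib_left mult_ac)
  finally show ?thesis .
qed

lemma conj_transpose_conj_transpose [simp]: "conj_transpose (conj_transpose X) = X"
  by (simp add: conj_transpose_def map_matrix_def transpose_def vec_eq_iff)

lemma scaleR_matrix_vector_mult:
  fixes X :: "complex ^ 'm ^ 'n"
  shows "(c *\<^sub>R X) *v x = c *\<^sub>R (X *v x)"
  by (simp add: vec_eq_iff matrix_vector_mult_def scaleR_sum_right)

lemma matrix_vector_mult_scaleR_complex:
  fixes X :: "complex ^ 'm ^ 'n"
  shows "X *v (c *\<^sub>R x) = c *\<^sub>R (X *v x)"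
  by (simp add: vec_eq_iff matrix_vector_mult_def scaleR_sum_right)

section \<open>Positive definite and semi-definite matrices\<close>

lemma hermitian_pd_hermitian: "hermitian_pd X \<Longrightarrow> conj_transpose X = X"
  by (simp add: hermitian_pd_def hermitian_def)

lemma hermitian_psd_nonneg: "hermitian_psd X \<Longrightarrow> 0 \<le> Re (herm_inner v (X *v v))"
  by (simp add: hermitian_psd_def sesq_form_eq_herm_inner)

lemma hermitian_pd_nonneg: "hermitian_pd X \<Longrightarrow> 0 \<le> Re (herm_inner v (X *v v))"
  by (cases "v = 0") (auto simp: hermitian_pd_def sesq_form_eq_herm_inner less_imp_le)

lemma hermitian_pd_eq_0:
  assumes "hermitian_pd X" and "Re (herm_inner v (X *v v)) \<le> 0"
  shows "v = 0"
  using assms by (force simp: hermitian_pd_def sesq_form_eq_herm_inner)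

section \<open>Square systems with trivial kernel\<close>

lemma trivial_kernel_imp_invertible:
  fixes X :: "'a::field ^ 'n ^ 'n"
  assumes "\<And>x. X *v x = 0 \<Longrightarrow> x = 0"
  shows "invertible X"
  using assms by (simp add: invertible_left_inverse matrix_left_invertible_ker)

lemma matrix_mult_matrix_inv:
  fixes X :: "'a::field ^ 'n ^ 'n"
  assumes "invertible X"
  shows "X ** matrix_inv X = mat 1"
  using assms unfolding invertible_def matrix_inv_def by (rule someI2_ex) blast

lemma matrix_mult_matrix_inv_vector:
  fixes X :: "'a::field ^ 'n ^ 'n"
  assumes "invertible X"
  shows "X *v (matrix_inv X *v b) = b"
  by (simp add: matrix_vector_mul_assoc matrix_mult_matrix_inv[OF assms])

lemma trivial_kernel_imp_ex1:
  fixes X :: "'a::field ^ 'n ^ 'n"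
  assumes "\<And>x. X *v x = 0 \<Longrightarrow> x = 0"
  shows "\<exists>!x. X *v x = b"
proof (rule ex_ex1I)
  have "X *v (matrix_inv X *v b) = b"
    by (rule matrix_mult_matrix_inv_vector[OF trivial_kernel_imp_invertible[OF assms]])
  then show "\<exists>x. X *v x = b" ..
next
  fix x y assume "X *v x = b" "X *v y = b"
  then show "x = y"
    using assms[of "x - y"] by (simp add: matrix_vector_mult_diff_distrib)
qed

lemma hermitian_pd_imp_invertible:
  assumes "hermitian_pd X"
  shows "invertible X"
proof (rule trivial_kernel_imp_invertible)
  fix x assume "X *v x = 0"
  then show "x = 0"
    using hermitian_pd_eq_0[OF assms, of x] by simp
qed

text \<open>The vectors \<open>x\<close> and \<open>z\<close> are kept apart because one application
  shifts \<open>u\<close> by \<open>u\<^sub>t\<close> in the \<open>A\<close> term and by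
  \<open>u\<^sub>g\<close> in the \<open>M\<close> term; the uniqueness argument takes
  \<open>x = z\<close>.\<close>

lemma constraint_term_eq_0:
  fixes A M :: "complex ^ 'n ^ 'n" and B :: "complex ^ 'm ^ 'n"
  assumes A: "hermitian_psd A" and M: "hermitian_pd M"
    and AMB: "A ** matrix_inv M ** B = 0" and c: "0 \<le> c"
    and eq: "A *v x + B *v q + c *\<^sub>R (M *v z) = 0"
    and q: "0 \<le> Re (herm_inner q (conj_transpose B *v z))"
  shows "B *v q = 0"
proof -
  define r where "r = matrix_inv M *v (B *v q)"
  have Mr: "M *v r = B *v q"
    by (simp add: r_def matrix_mult_matrix_inv_vector hermitian_pd_imp_invertible[OF M])
  have "A *v r = (A ** matrix_inv M ** B) *v q"
    by (simp add: r_def matrix_vector_mul_assoc matrix_mul_assoc)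
  then have Ar: "A *v r = 0"
    by (simp add: AMB)
  \<comment> \<open>\<open>r\<close> lies in the kernel of the Hermitian matrix \<open>A\<close>, so
    moving \<open>A\<close> to the left argument gives zero whatever \<open>x\<close> is.\<close>
  have 1: "herm_inner r (A *v x) = 0"
    using A Ar by (simp add: herm_inner_adjoint hermitian_psd_def hermitian_def)
  have "herm_inner r (M *v z) = herm_inner (B *v q) z"
    by (simp add: herm_inner_adjoint hermitian_pd_hermitian[OF M] Mr)
  also have "\<dots> = herm_inner q (conj_transpose B *v z)"
    by (simp add: herm_inner_adjoint)
  finally have 2: "herm_inner r (M *v z) = herm_inner q (conj_transpose B *v z)" .
  have "herm_inner r (A *v x + M *v r + c *\<^sub>R (M *v z)) = 0"
    using eq Mr by simp
  then have "herm_inner r (M *v r) + c *\<^sub>R herm_inner q (conj_transpose B *v z) = 0"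
    by (simp add: herm_inner_add_right herm_inner_scaleR_right 1 2)
  then have "Re (herm_inner r (M *v r)) + c * Re (herm_inner q (conj_transpose B *v z)) = 0"
    by (simp add: complex_eq_iff)
  moreover have "0 \<le> c * Re (herm_inner q (conj_transpose B *v z))"
    using c q by simp
  ultimately have "r = 0"
    by (intro hermitian_pd_eq_0[OF M]) linarith
  then show ?thesis
    using Mr by simp
qed

section \<open>Solvability on the range of the adjoint of \<open>B\<close>\<close>

lemma herm_inner_congruence:
  fixes B :: "complex ^ 'm ^ 'n"
  shows "herm_inner z (B *v (U *v (conj_transpose B *v z)))
    = herm_inner (conj_transpose B *v z) (U *v (conj_transpose B *v z))"
  by (rule herm_inner_adjoint)

text \<open>Pairing the hypothesis with \<open>z\<close> gives
  \<open>\<langle>y, U y\<rangle> = 0\<close> for \<open>y = B\<^sup>* z\<close>.\<close>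

lemma congruence_kernel:
  fixes B :: "complex ^ 'm ^ 'n"
  assumes "hermitian_pd U" and "B *v (U *v (conj_transpose B *v z)) = 0"
  shows "conj_transpose B *v z = 0"
  by (rule hermitian_pd_eq_0[OF assms(1)]) (simp add: assms(2) flip: herm_inner_congruence)

text \<open>Injectivity preserves the dimension, and a subspace of \<open>W\<close> of full
  dimension is all of \<open>W\<close>.\<close>

lemma inj_on_subspace_imp_surj:
  fixes X :: "'a::field ^ 'n ^ 'n"
  assumes "vec.subspace W" and "\<And>y. y \<in> W \<Longrightarrow> X *v y \<in> W"
    and "\<And>y. y \<in> W \<Longrightarrow> X *v y = 0 \<Longrightarrow> y = 0"
  shows "(*v) X ` W = W"
proof (rule vec.subspace_dim_equal)
  show "vec.subspace ((*v) X ` W)"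
    using matrix_vector_mul_linear_gen assms(1) by (rule vec.linear_subspace_image)
  have "inj_on ((*v) X) W"
    using matrix_vector_mul_linear_gen assms(1,3)
    by (subst vec.linear_inj_on_iff_eq_0) auto
  then have "vec.dim ((*v) X ` W) = vec.dim W"
    using matrix_vector_mul_linear_gen assms(1)
    by (intro vec.dim_image_eq) (simp_all add: vec.span_eq_iff[THEN iffD2])
  then show "vec.dim W \<le> vec.dim ((*v) X ` W)"
    by simp
qed (use assms in auto)

text \<open>The map \<open>B\<^sup>* M\<inverse> B U\<close> is injective on the range of
  \<open>B\<^sup>*\<close>, hence onto it. The factor \<open>U\<close> makes
  \<open>congruence_kernel\<close> applicable and is finally absorbed into
  \<open>q = U y\<close>.\<close>

lemma ex_matrix_inv_constraint:
  fixes M :: "complex ^ 'n ^ 'n" and B :: "complex ^ 'm ^ 'n"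
    and U :: "complex ^ 'm ^ 'm"
  assumes M: "hermitian_pd M" and U: "hermitian_pd U" and G: "G \<in> mat_Im (conj_transpose B)"
  obtains q where "conj_transpose B *v (matrix_inv M *v (B *v q)) = G"
proof -
  let ?B' = "conj_transpose B"
  let ?W = "mat_Im ?B'"
  let ?Y = "?B' ** matrix_inv M ** B ** U"
  have Y: "?Y *v y = ?B' *v (matrix_inv M *v (B *v (U *v y)))" for y
    by (simp flip: matrix_vector_mul_assoc)
  have "(*v) ?Y ` ?W = ?W"
  proof (rule inj_on_subspace_imp_surj)
    show "vec.subspace ?W"
      unfolding mat_Im_def
      using matrix_vector_mul_linear_gen vec.subspace_UNIV by (rule vec.linear_subspace_image)
    show "?Y *v y \<in> ?W" for y
      by (simp add: Y mat_Im_def)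
    fix y assume "y \<in> ?W" and "?Y *v y = 0"
    then obtain z where z: "y = ?B' *v z"
      by (auto simp: mat_Im_def)
    define r where "r = matrix_inv M *v (B *v (U *v y))"
    have Mr: "M *v r = B *v (U *v y)"
      by (simp add: r_def matrix_mult_matrix_inv_vector hermitian_pd_imp_invertible[OF M])
    have "?B' *v r = 0"
      using \<open>?Y *v y = 0\<close> by (simp add: Y r_def)
    \<comment> \<open>Here \<open>\<langle>r, B U y\<rangle> = \<langle>B\<^sup>* r, U
      y\<rangle>\<close>, and \<open>B\<^sup>* r = 0\<close>.\<close>
    then have "herm_inner r (M *v r) = 0"
      by (simp add: Mr herm_inner_adjoint[of r B])
    then have "r = 0"
      by (intro hermitian_pd_eq_0[OF M]) simp
    then show "y = 0"
      using congruence_kernel[OF U, of B z] Mr z by simp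
  qed
  then obtain y where "?Y *v y = G"
    using G by (metis imageE)
  then show thesis
    using that Y by metis
qed

text \<open>With \<open>q = U B\<^sup>* z\<close> the sign condition of
  \<open>constraint_term_eq_0\<close> is the positivity of \<open>U\<close>.\<close>

lemma conj_transpose_mult_eq_0:
  fixes A M :: "complex ^ 'n ^ 'n" and B :: "complex ^ 'm ^ 'n"
  assumes A: "hermitian_psd A" and M: "hermitian_pd M"
    and AMB: "A ** matrix_inv M ** B = 0" and c: "0 \<le> c" and U: "hermitian_pd U"
    and eq: "A *v x + B *v (U *v (conj_transpose B *v z)) + c *\<^sub>R (M *v z) = 0"
  shows "conj_transpose B *v z = 0"
proof -
  let ?y = "conj_transpose B *v z"
  have "herm_inner (U *v ?y) ?y = herm_inner ?y (U *v ?y)"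
    by (simp add: herm_inner_adjoint hermitian_pd_hermitian[OF U])
  then have "0 \<le> Re (herm_inner (U *v ?y) ?y)"
    using hermitian_pd_nonneg[OF U, of ?y] by simp
  from constraint_term_eq_0[OF A M AMB c eq this] show ?thesis
    by (rule congruence_kernel[OF U])
qed

text \<open>Pairing with \<open>z\<close> gives three nonnegative terms of sum zero, so each
  vanishes. For \<open>c > 0\<close> definiteness of \<open>M\<close> concludes; for
  \<open>c = 0\<close> the vector \<open>z\<close> lies in \<open>C0_space A B U\<close>.\<close>

lemma augmented_kernel:
  fixes A M :: "complex ^ 'n ^ 'n" and B :: "complex ^ 'm ^ 'n"
  assumes A: "hermitian_psd A" and M: "hermitian_pd M" and U: "hermitian_pd U" and c: "0 \<le> c"
    and C0: "C0_space A B U \<subseteq> {0}"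
    and eq: "A *v z + B *v (U *v (conj_transpose B *v z)) + c *\<^sub>R (M *v z) = 0"
  shows "z = 0"
proof -
  let ?y = "conj_transpose B *v z"
  have "herm_inner z (A *v z + B *v (U *v ?y) + c *\<^sub>R (M *v z)) = 0"
    by (simp add: eq)
  then have "herm_inner z (A *v z) + herm_inner ?y (U *v ?y) + c *\<^sub>R herm_inner z (M *v z) = 0"
    by (simp add: herm_inner_add_right herm_inner_scaleR_right herm_inner_congruence)
  then have sum0: "Re (herm_inner z (A *v z)) + Re (herm_inner ?y (U *v ?y))
      + c * Re (herm_inner z (M *v z)) = 0"
    by (simp add: complex_eq_iff)
  have nonneg: "0 \<le> c * Re (herm_inner z (M *v z))"
    using c hermitian_pd_nonneg[OF M] by simp
  have y: "?y = 0"
    using sum0 nonneg hermitian_psd_nonneg[OF A, of z]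
    by (intro hermitian_pd_eq_0[OF U]) linarith
  show ?thesis
  proof (cases "c = 0")
    case True
    then have "z \<in> C0_space A B U"
      using eq y by (simp add: C0_space_def mat_Ker_def flip: matrix_vector_mul_assoc)
    then show ?thesis
      using C0 by blast
  next
    case False
    have "c * Re (herm_inner z (M *v z)) \<le> 0"
      using sum0 hermitian_psd_nonneg[OF A, of z] hermitian_pd_nonneg[OF U, of ?y] by linarith
    then show ?thesis
      using False c by (intro hermitian_pd_eq_0[OF M]) (simp add: mult_le_0_iff)
  qed
qed

theorem mainTheorem6:
  fixes A M :: "complex ^ 'n ^ 'n"
    and B :: "complex ^ 'm ^ 'n"
    and U :: "complex ^ 'm ^ 'm"
    and c :: real
    and F :: "complex ^ 'n"
    and G :: "complex ^ 'm"
  assumes "hermitian_psd A"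
    and "hermitian_pd M"
    and "A ** matrix_inv M ** B = 0"
    and "hermitian_pd U"
    and "0 \<le> c"
    and "G \<noteq> 0"
    and "G \<in> mat_Im (conj_transpose B)"
    and "vec.dim (C0_space A B U) = 0"
  shows "(\<exists>!u\<^sub>g. (A + B ** U ** conj_transpose B) *v u\<^sub>g = (B ** U) *v G) \<and>
    (\<exists>!u\<^sub>t. (A + B ** U ** conj_transpose B) *v u\<^sub>t = F) \<and>
    (\<exists>u.
      (\<exists>p. (A + c *\<^sub>R M) *v u + B *v p = F \<and> conj_transpose B *v u = G) \<and>
      (\<forall>u' p'. (A + c *\<^sub>R M) *v u' + B *v p' = F \<and> conj_transpose B *v u' = G \<longrightarrow> u' = u) \<and>
      (\<forall>u\<^sub>g u\<^sub>t.
        (A + B ** U ** conj_transpose B) *v u\<^sub>g = (B ** U) *v G \<and>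
        (A + B ** U ** conj_transpose B) *v u\<^sub>t = F \<longrightarrow>
        (\<forall>w. (A + B ** U ** conj_transpose B + c *\<^sub>R M) *v w
              = F - (B ** U ** conj_transpose B) *v u\<^sub>t + (B ** U) *v G + c *\<^sub>R (M *v u\<^sub>g)
            \<longleftrightarrow> w = u)))"
proof -
  note A = assms(1) and M = assms(2) and AMB = assms(3) and U = assms(4) and c = assms(5)
  note expand = matrix_vector_mult_add_rdistrib scaleR_matrix_vector_mult
    matrix_vector_mul_assoc[symmetric]
  have C0: "C0_space A B U \<subseteq> {0}"
    using assms(8) by (simp add: vec.dim_eq_0)
  let ?B' = "conj_transpose B"
  let ?S = "A + B ** U ** ?B'"
  have S_ker: "z = 0" if "?S *v z = 0" for z
    using augmented_kernel[OF A M U order_refl C0, of z] that by (simp add: expand)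
  have T_ker: "z = 0" if "(?S + c *\<^sub>R M) *v z = 0" for z
    using augmented_kernel[OF A M U c C0, of z] that by (simp add: expand)
  have ex1_S: "\<exists>!x. ?S *v x = b" for b
    using S_ker by (rule trivial_kernel_imp_ex1)
  obtain u\<^sub>g where ug: "?S *v u\<^sub>g = (B ** U) *v G"
    using ex1_S by blast
  obtain u\<^sub>t where ut: "?S *v u\<^sub>t = F"
    using ex1_S by blast
  let ?rhs = "F - (B ** U ** ?B') *v u\<^sub>t + (B ** U) *v G + c *\<^sub>R (M *v u\<^sub>g)"
  obtain u where u: "(?S + c *\<^sub>R M) *v u = ?rhs"
    and u_unique: "\<And>w. (?S + c *\<^sub>R M) *v w = ?rhs \<Longrightarrow> w = u"
    using trivial_kernel_imp_ex1[of "?S + c *\<^sub>R M", OF T_ker] by metis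
  obtain q where q: "?B' *v (matrix_inv M *v (B *v q)) = G"
    using ex_matrix_inv_constraint[OF M U assms(7)] .
  define w where "w = matrix_inv M *v (B *v q)"
  have B_w: "?B' *v w = G"
    by (simp add: q w_def)
  have M_w: "M *v w = B *v q"
    by (simp add: w_def matrix_mult_matrix_inv_vector hermitian_pd_imp_invertible[OF M])
  \<comment> \<open>As \<open>A w = 0\<close> and \<open>B\<^sup>* w = G\<close>, the vector
    \<open>w\<close> solves the system that determines \<open>u\<^sub>g\<close>.\<close>
  have "A *v w = (A ** matrix_inv M ** B) *v q"
    by (simp add: w_def flip: matrix_vector_mul_assoc)
  then have "?S *v w = (B ** U) *v G"
    by (simp add: expand AMB B_w)
  then have "w = u\<^sub>g"
    using ug ex1_S by metis
  with B_w M_w have B_ug: "?B' *v u\<^sub>g = G" and M_ug: "M *v u\<^sub>g = B *v q"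
    by simp_all
  have "?B' *v (u - u\<^sub>g) = 0"
  proof (rule conj_transpose_mult_eq_0[OF A M AMB c U, where x = "u - u\<^sub>t"])
    \<comment> \<open>Substituting \<open>F = A u\<^sub>t + B U B\<^sup>* u\<^sub>t\<close> into the
      right-hand side cancels its \<open>B U B\<^sup>* u\<^sub>t\<close>, and
      \<open>G = B\<^sup>* u\<^sub>g\<close> rewrites \<open>B U G\<close>.\<close>
    show "A *v (u - u\<^sub>t) + B *v (U *v (?B' *v (u - u\<^sub>g))) + c *\<^sub>R (M *v (u - u\<^sub>g)) = 0"
      using u ut by (auto simp: B_ug expand matrix_vector_mult_diff_distrib algebra_simps)
  qed
  then have B_u: "?B' *v u = G"
    by (simp add: B_ug matrix_vector_mult_diff_distrib)
  \<comment> \<open>Since \<open>B\<^sup>* u = G\<close>, the terms \<open>B U G\<close> on both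
    sides cancel.\<close>
  have "(A + c *\<^sub>R M) *v u + B *v (U *v (?B' *v u\<^sub>t)) = F + c *\<^sub>R (B *v q)"
    using u by (simp add: expand B_u M_ug algebra_simps)
  then have solves: "(A + c *\<^sub>R M) *v u + B *v (U *v (?B' *v u\<^sub>t) - c *\<^sub>R q) = F"
    by (simp add: matrix_vector_mult_diff_distrib
        matrix_vector_mult_scaleR_complex algebra_simps)
  have unique: "u' = u"
    if "(A + c *\<^sub>R M) *v u' + B *v p' = F" and B_u': "?B' *v u' = G" for u' p'
  proof -
    define p where "p = U *v (?B' *v u\<^sub>t) - c *\<^sub>R q"
    have eq: "A *v (u' - u) + B *v (p' - p) + c *\<^sub>R (M *v (u' - u)) = 0"
      using that(1) solves[folded p_def]
      by (auto simp: expand matrix_vector_mult_diff_distrib algebra_simps)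
    have B_diff: "?B' *v (u' - u) = 0"
      by (simp add: B_u B_u' matrix_vector_mult_diff_distrib)
    have "B *v (p' - p) = 0"
      by (rule constraint_term_eq_0[OF A M AMB c eq]) (simp add: B_diff)
    \<comment> \<open>The multiplier term is gone, and \<open>B U B\<^sup>* (u' - u) = 0\<close> may
      be added to reach the augmented equation.\<close>
    then have "u' - u = 0"
      using augmented_kernel[OF A M U c C0, of "u' - u"] eq by (simp add: B_diff)
    then show ?thesis
      by simp
  qed
  have characterization:
    "(?S + c *\<^sub>R M) *v w = F - (B ** U ** ?B') *v t + (B ** U) *v G + c *\<^sub>R (M *v g) \<longleftrightarrow> w = u"
    if "?S *v g = (B ** U) *v G" and "?S *v t = F" for g t w
  proof -
    \<comment> \<open>The auxiliary solutions are universally quantified in the claim; uniqueness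
      identifies them with the chosen ones.\<close>
    have "g = u\<^sub>g" "t = u\<^sub>t"
      using that ug ut ex1_S by metis+
    then show ?thesis
      using u u_unique by metis
  qed
  show ?thesis
    by (intro conjI exI[of _ u] exI[of _ "U *v (?B' *v u\<^sub>t) - c *\<^sub>R q"] allI impI ex1_S solves B_u)
      (elim conjE, (rule unique characterization; assumption))+
qed

end
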